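(* Let $(I,\tilde g,V,\lambda,\mu)$ be an almost $\eta$-Ricci soliton with $V=\frac{\partial}{\partial x^3}$. Suppose that $f_1,f_2$ depend only on $x^3$, that the components of $\eta=\sum_{k=1}^3\eta^ke_k$ are all equal, $\eta^1=\eta^2=\eta^3=:f$, and that $\mu$ is nowhere zero on $I$. Then $\eta=0$. Moreover: (i) if one of the functions $f_1$ and $f_2$ is constant, then the other one is constant, too; in this case, $(I,\tilde g)$ is a flat Riemannian manifold, $\lambda=0$, and $V$ is a Killing vector field; (ii) if $\frac{f_1}{f_2}$ is constant, then $f_i(x^3)=c_ie^{c_0e^{-x^3}}$ for $i\in\{1,2\}$, where $c_0\in\mathbb R$ and $c_1,c_2\in\mathbb R\setminus\{0\}$.
   Context: Let $I=I_1\times I_2\times I_3\subseteq\mathbb R^3$ with $I_1,I_2,I_3\subseteq\mathbb R$ open intervals and standard coordinates $x^1,x^2,x^3$. Let $f_1,f_2$ be smooth nowhere zero functions on $I$ and endow $I$ with the Riemannian metric $\tilde g=\frac{1}{f_1^2}dx^1\otimes dx^1+\frac{1}{f_2^2}dx^2\otimes dx^2+dx^3\otimes dx^3$. Let $E_1=f_1\frac{\partial}{\partial x^1}$, $E_2=f_2\frac{\partial}{\partial x^2}$, $E_3=\frac{\partial}{\partial x^3}$ (an orthonormal frame), and let $e_1,e_2,e_3$ be the dual $1$-forms. For a smooth vector field $V$, a $1$-form $\eta$, and smooth functions $\lambda,\mu$ on $I$ with $\mu\neq0$, $(I,\tilde g,V,\lambda,\mu)$ is an almost $\eta$-Ricci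 soliton if $\frac12\pounds_V\tilde g+\mathrm{Ric}+\lambda\tilde g+\mu\,\eta\otimes\eta=0$ on $I$, where $\pounds_V\tilde g$ is the Lie derivative of $\tilde g$ along $V$ and $\mathrm{Ric}$ is the Ricci tensor of $\tilde g$, with $\mathrm{Ric}(Y,Z)=\sum_{k}\tilde g(R(E_k,Y)Z,E_k)$, $R(X,Y)Z=\nabla_X\nabla_YZ-\nabla_Y\nabla_XZ-\nabla_{[X,Y]}Z$, $\nabla$ the Levi-Civita connection. $V$ is Killing if $\pounds_V\tilde g=0$; flat means $R=0$. *)

theory Defs
  imports "HOL-Analysis.Analysis"
begin

text \<open>
  Tensor calculus on an open subset \<open>U\<close> of a Euclidean space \<open>'a\<close>, with every tangent space
  identified with \<open>'a\<close>.  Fields are total functions on \<open>'a\<close>; only their values on \<open>U\<close> are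
  meaningful, and since \<open>U\<close> is open, so are the derivatives taken at points of \<open>U\<close>.
\<close>

primrec Ck_on :: "nat \<Rightarrow> ('a::euclidean_space \<Rightarrow> 'b::real_normed_vector) \<Rightarrow> 'a set \<Rightarrow> bool" where
  "Ck_on 0 h U \<longleftrightarrow> continuous_on U h"
| "Ck_on (Suc n) h U \<longleftrightarrow> (\<forall>x\<in>U. h differentiable (at x)) \<and>
     (\<forall>v. Ck_on n (\<lambda>x. frechet_derivative h (at x) v) U)"

definition smooth_on :: "'a::euclidean_space set \<Rightarrow> ('a \<Rightarrow> 'b::real_normed_vector) \<Rightarrow> bool" where
  "smooth_on U h \<longleftrightarrow> (\<forall>n. Ck_on n h U)"

type_synonym 'a vfield = "'a \<Rightarrow> 'a"
type_synonym 'a oneform = "'a \<Rightarrow> 'a \<Rightarrow> real"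
type_synonym 'a tensor2 = "'a \<Rightarrow> 'a \<Rightarrow> 'a \<Rightarrow> real"
type_synonym 'a connection = "'a vfield \<Rightarrow> 'a vfield \<Rightarrow> 'a vfield"

definition one_form_on :: "'a::euclidean_space set \<Rightarrow> 'a oneform \<Rightarrow> bool" where
  "one_form_on U \<eta> \<longleftrightarrow> (\<forall>p\<in>U. linear (\<eta> p)) \<and> (\<forall>v. smooth_on U (\<lambda>p. \<eta> p v))"

definition vderiv :: "'a::euclidean_space vfield \<Rightarrow> ('a \<Rightarrow> real) \<Rightarrow> 'a \<Rightarrow> real" where
  "vderiv X h p = frechet_derivative h (at p) (X p)"

definition lie_bracket :: "'a::euclidean_space vfield \<Rightarrow> 'a vfield \<Rightarrow> 'a vfield" where
  "lie_bracket X Y p = frechet_derivative Y (at p) (X p) - frechet_derivative X (at p) (Y p)"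

definition lie_deriv_metric ::
    "'a::euclidean_space tensor2 \<Rightarrow> 'a vfield \<Rightarrow> 'a vfield \<Rightarrow> 'a vfield \<Rightarrow> 'a \<Rightarrow> real" where
  "lie_deriv_metric g V Y Z p = vderiv V (\<lambda>q. g q (Y q) (Z q)) p
     - g p (lie_bracket V Y p) (Z p) - g p (Y p) (lie_bracket V Z p)"

definition affine_connection_on :: "'a::euclidean_space set \<Rightarrow> 'a connection \<Rightarrow> bool" where
  "affine_connection_on U D \<longleftrightarrow>
     (\<forall>X Y. smooth_on U X \<longrightarrow> smooth_on U Y \<longrightarrow> smooth_on U (D X Y)) \<and>
     (\<forall>X X' Y. smooth_on U X \<longrightarrow> smooth_on U X' \<longrightarrow> smooth_on U Y \<longrightarrow>
        (\<forall>p\<in>U. D (\<lambda>q. X q + X' q) Y p = D X Y p + D X' Y p)) \<and>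
     (\<forall>h X Y. smooth_on U h \<longrightarrow> smooth_on U X \<longrightarrow> smooth_on U Y \<longrightarrow>
        (\<forall>p\<in>U. D (\<lambda>q. h q *\<^sub>R X q) Y p = h p *\<^sub>R D X Y p)) \<and>
     (\<forall>X Y Y'. smooth_on U X \<longrightarrow> smooth_on U Y \<longrightarrow> smooth_on U Y' \<longrightarrow>
        (\<forall>p\<in>U. D X (\<lambda>q. Y q + Y' q) p = D X Y p + D X Y' p)) \<and>
     (\<forall>h X Y. smooth_on U h \<longrightarrow> smooth_on U X \<longrightarrow> smooth_on U Y \<longrightarrow>
        (\<forall>p\<in>U. D X (\<lambda>q. h q *\<^sub>R Y q) p = vderiv X h p *\<^sub>R Y p + h p *\<^sub>R D X Y p))"

text \<open>The torsion-free metric connection of \<open>g\<close>; it is unique as an operator on smooth fields on \<open>U\<close>.\<close>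

definition levi_civita_on ::
    "'a::euclidean_space set \<Rightarrow> 'a tensor2 \<Rightarrow> 'a connection \<Rightarrow> bool" where
  "levi_civita_on U g D \<longleftrightarrow> affine_connection_on U D \<and>
     (\<forall>X Y. smooth_on U X \<longrightarrow> smooth_on U Y \<longrightarrow>
        (\<forall>p\<in>U. D X Y p - D Y X p = lie_bracket X Y p)) \<and>
     (\<forall>X Y Z. smooth_on U X \<longrightarrow> smooth_on U Y \<longrightarrow> smooth_on U Z \<longrightarrow>
        (\<forall>p\<in>U. vderiv X (\<lambda>q. g q (Y q) (Z q)) p = g p (D X Y p) (Z p) + g p (Y p) (D X Z p)))"

definition curvature ::
    "'a::euclidean_space connection \<Rightarrow> 'a vfield \<Rightarrow> 'a vfield \<Rightarrow> 'a vfield \<Rightarrow> 'a vfield" where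
  "curvature D X Y Z p = D X (D Y Z) p - D Y (D X Z) p - D (lie_bracket X Y) Z p"

text \<open>In the following definition, \<open>E\<close> is meant to be an orthonormal frame of \<open>g\<close>.\<close>

definition ricci :: "'a::euclidean_space tensor2 \<Rightarrow> 'a connection \<Rightarrow> ('k::finite \<Rightarrow> 'a vfield) \<Rightarrow>
    'a vfield \<Rightarrow> 'a vfield \<Rightarrow> 'a \<Rightarrow> real" where
  "ricci g D E Y Z p = (\<Sum>k\<in>UNIV. g p (curvature D (E k) Y Z p) (E k p))"

definition flat_on :: "'a::euclidean_space set \<Rightarrow> 'a connection \<Rightarrow> bool" where
  "flat_on U D \<longleftrightarrow> (\<forall>X Y Z. smooth_on U X \<longrightarrow> smooth_on U Y \<longrightarrow> smooth_on U Z \<longrightarrow>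
     (\<forall>p\<in>U. curvature D X Y Z p = 0))"

definition killing_on :: "'a::euclidean_space set \<Rightarrow> 'a tensor2 \<Rightarrow> 'a vfield \<Rightarrow> bool" where
  "killing_on U g V \<longleftrightarrow> smooth_on U V \<and>
     (\<forall>Y Z. smooth_on U Y \<longrightarrow> smooth_on U Z \<longrightarrow> (\<forall>p\<in>U. lie_deriv_metric g V Y Z p = 0))"

text \<open>The condition \<open>\<mu> \<noteq> 0\<close> in the notion of a soliton is read as ``not identically zero''.\<close>

definition almost_eta_ricci_soliton ::
    "'a::euclidean_space set \<Rightarrow> 'a tensor2 \<Rightarrow> 'a connection \<Rightarrow> ('k::finite \<Rightarrow> 'a vfield) \<Rightarrow>
     'a vfield \<Rightarrow> 'a oneform \<Rightarrow> ('a \<Rightarrow> real) \<Rightarrow> ('a \<Rightarrow> real) \<Rightarrow> bool" where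
  "almost_eta_ricci_soliton U g D E V \<eta> lam \<mu> \<longleftrightarrow>
     smooth_on U V \<and> one_form_on U \<eta> \<and> smooth_on U lam \<and> smooth_on U \<mu> \<and> (\<exists>p\<in>U. \<mu> p \<noteq> 0) \<and>
     (\<forall>Y Z. smooth_on U Y \<longrightarrow> smooth_on U Z \<longrightarrow>
        (\<forall>p\<in>U. 1/2 * lie_deriv_metric g V Y Z p + ricci g D E Y Z p
               + lam p * g p (Y p) (Z p) + \<mu> p * (\<eta> p (Y p) * \<eta> p (Z p)) = 0))"

definition dual_coframe_on ::
    "'a::euclidean_space set \<Rightarrow> ('k \<Rightarrow> 'a vfield) \<Rightarrow> ('k \<Rightarrow> 'a oneform) \<Rightarrow> bool" where
  "dual_coframe_on U E e \<longleftrightarrow> (\<forall>p\<in>U. \<forall>j. linear (e j p) \<and>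
     (\<forall>k. e j p (E k p) = (if j = k then 1 else 0)))"

definition box3 :: "real set \<Rightarrow> real set \<Rightarrow> real set \<Rightarrow> (real^3) set" where
  "box3 I1 I2 I3 = {p. p $ 1 \<in> I1 \<and> p $ 2 \<in> I2 \<and> p $ 3 \<in> I3}"

definition g_tilde :: "(real^3 \<Rightarrow> real) \<Rightarrow> (real^3 \<Rightarrow> real) \<Rightarrow> (real^3) tensor2" where
  "g_tilde f1 f2 p u v = 1 / (f1 p)\<^sup>2 * (u $ 1 * v $ 1) + 1 / (f2 p)\<^sup>2 * (u $ 2 * v $ 2) + u $ 3 * v $ 3"

definition frame3 :: "(real^3 \<Rightarrow> real) \<Rightarrow> (real^3 \<Rightarrow> real) \<Rightarrow> 3 \<Rightarrow> (real^3) vfield" where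
  "frame3 f1 f2 k p = (if k = 1 then f1 p *\<^sub>R axis 1 1
     else if k = 2 then f2 p *\<^sub>R axis 2 1 else axis 3 1)"

lemma frame3_orthonormal:
  assumes "f1 p \<noteq> 0" "f2 p \<noteq> 0"
  shows "g_tilde f1 f2 p (frame3 f1 f2 j p) (frame3 f1 f2 k p) = (if j = k then 1 else 0)"
  using exhaust_3[of j] exhaust_3[of k] assms
  by (auto simp: g_tilde_def frame3_def axis_def power2_eq_square)

end

theory Submission
  imports Defs
begin

text \<open>
  For \<open>a = f\<^sub>1' / f\<^sub>1\<close> and \<open>b = f\<^sub>2' / f\<^sub>2\<close>, Koszul's formula in the orthonormal frame shows that
  \<open>Ric(E\<^sub>1, E\<^sub>2) = 0\<close>, so that component of the soliton equation is \<open>\<mu> f\<^sup>2 = 0\<close> and \<open>\<eta>\<close> vanishes.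
  The diagonal components become
  \<open>a' - a\<^sup>2 - a b - a + \<lambda> = 0\<close>, \<open>b' - b\<^sup>2 - a b - b + \<lambda> = 0\<close> and \<open>a' - a\<^sup>2 + b' - b\<^sup>2 + \<lambda> = 0\<close>.
  If \<open>a = 0\<close>, the first gives \<open>\<lambda> = 0\<close> and the other two give \<open>b = 0\<close>; the metric coefficients are
  then constant, \<open>D X Y\<close> is the directional derivative of \<open>Y\<close> along \<open>X\<close>, and flatness is the
  symmetry of second derivatives.  If \<open>a = b\<close>, subtracting the first equation from the third gives
  \<open>a' = - a\<close>, which integrates to the double exponential.
\<close>

subsection \<open>Smooth functions and second derivatives\<close>

text \<open>Fields are total functions controlled only on \<open>U\<close>, so derivative formulas
  hold only there. Since \<open>U\<close> is open, a derivative at a point of \<open>U\<close>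
  depends only on values in \<open>U\<close>, and this passes through the recursion of
  \<open>Ck_on\<close>.\<close>

lemma Ck_on_cong:
  assumes "open U" "\<And>x. x \<in> U \<Longrightarrow> h x = k x" "Ck_on n h U"
  shows "Ck_on n k U"
  using assms(2,3)
proof (induction n arbitrary: h k)
  case 0
  then show ?case
    using continuous_on_cong by (metis Ck_on.simps(1))
next
  case (Suc n)
  have "frechet_derivative k (at x) = frechet_derivative h (at x)" if "x \<in> U" for x
    using frechet_derivative_transform_within_open[of h x U k] Suc.prems that \<open>open U\<close> by auto
  moreover have "k differentiable (at x)" if "x \<in> U" for x
    using has_derivative_transform_within_open[of h _ x UNIV U k] Suc.prems that \<open>open U\<close>
    unfolding differentiable_def Ck_on.simps by metis
  ultimately show ?case
    using Suc.prems(2) Suc.IH[of "\<lambda>x. frechet_derivative h (at x) v" "\<lambda>x. frechet_derivative k (at x) v" for v]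
    by auto
qed

lemma Ck_on_bounded_linear:
  assumes "open U" "bounded_linear L" "Ck_on n h U"
  shows "Ck_on n (\<lambda>x. L (h x)) U"
  using assms(3)
proof (induction n arbitrary: h)
  case 0
  then show ?case
    using bounded_linear.continuous_on[OF assms(2)] by simp
next
  case (Suc n)
  have der: "((\<lambda>x. L (h x)) has_derivative (\<lambda>v. L (frechet_derivative h (at x) v))) (at x)"
    if "x \<in> U" for x
    using Suc.prems that by (intro bounded_linear.has_derivative[OF assms(2)])
      (auto simp: frechet_derivative_works[symmetric])
  have "Ck_on n (\<lambda>x. frechet_derivative (\<lambda>x. L (h x)) (at x) v) U" for v
    by (rule Ck_on_cong[OF \<open>open U\<close> _ Suc.IH[of "\<lambda>x. frechet_derivative h (at x) v"]])
      (use der frechet_derivative_at[OF der] Suc.prems in \<open>auto simp: fun_eq_iff\<close>)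
  then show ?case
    using der by (auto simp: differentiable_def)
qed

lemma Ck_on_add:
  assumes "open U" "Ck_on n h U" "Ck_on n k U"
  shows "Ck_on n (\<lambda>x. h x + k x) U"
  using assms(2,3)
proof (induction n arbitrary: h k)
  case 0
  then show ?case by (auto intro: continuous_on_add)
next
  case (Suc n)
  have der: "((\<lambda>x. h x + k x) has_derivative
      (\<lambda>v. frechet_derivative h (at x) v + frechet_derivative k (at x) v)) (at x)"
    if "x \<in> U" for x
    using Suc.prems that by (intro has_derivative_add) (auto simp: frechet_derivative_works[symmetric])
  have "Ck_on n (\<lambda>x. frechet_derivative (\<lambda>x. h x + k x) (at x) v) U" for v
    by (rule Ck_on_cong[OF \<open>open U\<close> _ Suc.IH[of "\<lambda>x. frechet_derivative h (at x) v"
            "\<lambda>x. frechet_derivative k (at x) v"]])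
      (use der frechet_derivative_at[OF der] Suc.prems in \<open>auto simp: fun_eq_iff\<close>)
  then show ?case
    using der by (auto simp: differentiable_def)
qed

lemma smooth_on_cong:
  assumes "open U" "\<And>x. x \<in> U \<Longrightarrow> h x = k x" "smooth_on U h"
  shows "smooth_on U k"
  using Ck_on_cong[OF assms(1)] assms(2,3) unfolding smooth_on_def by blast

lemma smooth_on_const: "smooth_on U (\<lambda>_. c)"
proof -
  have "Ck_on n (\<lambda>_. c) U" for n
    \<comment> \<open>\<open>c\<close> is generalised because the derivative of a constant is again
      constant, with value 0.\<close>
    by (induction n arbitrary: c) auto
  then show ?thesis by (simp add: smooth_on_def)
qed

lemma smooth_on_bounded_linear:
  assumes "open U" "bounded_linear L" "smooth_on U h"
  shows "smooth_on U (\<lambda>x. L (h x))"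
  using Ck_on_bounded_linear[OF assms(1,2)] assms(3) by (auto simp: smooth_on_def)

lemma smooth_on_add:
  assumes "open U" "smooth_on U h" "smooth_on U k"
  shows "smooth_on U (\<lambda>x. h x + k x)"
  using Ck_on_add[OF assms(1)] assms(2,3) unfolding smooth_on_def by blast

lemma smooth_on_diff:
  assumes "open U" "smooth_on U h" "smooth_on U k"
  shows "smooth_on U (\<lambda>x. h x - k x)"
  using smooth_on_add[OF assms(1,2) smooth_on_bounded_linear[OF assms(1) _ assms(3), of uminus]]
  by (simp add: bounded_linear_minus bounded_linear_ident)

lemma smooth_on_Ck_on: "smooth_on U h \<Longrightarrow> Ck_on n h U"
  by (simp add: smooth_on_def)

lemma smooth_on_differentiable:
  "smooth_on U h \<Longrightarrow> p \<in> U \<Longrightarrow> h differentiable (at p)"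
  using smooth_on_Ck_on[of U h 1] by simp

lemma smooth_on_has_derivative:
  "smooth_on U h \<Longrightarrow> p \<in> U \<Longrightarrow> (h has_derivative frechet_derivative h (at p)) (at p)"
  using smooth_on_differentiable frechet_derivative_works by blast

lemma smooth_on_frechet_derivative:
  assumes "smooth_on U h"
  shows "smooth_on U (\<lambda>p. frechet_derivative h (at p) v)"
  using smooth_on_Ck_on[OF assms, of "Suc n" for n] by (auto simp: smooth_on_def)

lemma frechet_derivative_cong_open:
  assumes "open U" "p \<in> U" "\<And>x. x \<in> U \<Longrightarrow> h x = k x"
  shows "frechet_derivative h (at p) = frechet_derivative k (at p)"
proof -
  have "(h has_derivative D) (at p) \<longleftrightarrow> (k has_derivative D) (at p)" for D
    using has_derivative_transform_within_open[of _ D p UNIV U] assms by metis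
  then show ?thesis by (simp add: frechet_derivative_def)
qed

section \<open>Symmetry of second derivatives\<close>

lemma has_real_derivative_along_line:
  fixes h :: "'a::real_normed_vector \<Rightarrow> real"
  assumes "h differentiable (at (a + s *\<^sub>R u))"
  shows "((\<lambda>s. h (a + s *\<^sub>R u)) has_real_derivative frechet_derivative h (at (a + s *\<^sub>R u)) u) (at s)"
proof -
  let ?D = "frechet_derivative h (at (a + s *\<^sub>R u))"
  have D: "(h has_derivative ?D) (at (a + s *\<^sub>R u))"
    using assms frechet_derivative_works by blast
  have "((\<lambda>s. a + s *\<^sub>R u) has_derivative (\<lambda>r. r *\<^sub>R u)) (at s)"
    by (auto intro!: derivative_eq_intros)
  from has_derivative_compose[OF this D]
  have "((\<lambda>s. h (a + s *\<^sub>R u)) has_derivative (\<lambda>r. ?D (r *\<^sub>R u))) (at s)" .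
  moreover have "?D (r *\<^sub>R u) = ?D u * r" for r
    using linear_cmul[OF has_derivative_linear[OF D]] by (simp add: mult.commute)
  ultimately show ?thesis by (simp add: has_field_derivative_def)
qed

text \<open>The mean value theorem is applied twice: first in direction \<open>u\<close> to the
  increment of \<open>h\<close> along \<open>t *\<^sub>R v\<close>, then in direction
  \<open>v\<close> to the derivative of \<open>h\<close> along \<open>u\<close>. The bound on
  \<open>t\<close> keeps the whole parallelogram inside the ball.\<close>

lemma second_difference_mvt:
  fixes h :: "'a::real_normed_vector \<Rightarrow> real"
  assumes t: "0 < t" "t * (norm u + norm v) < r"
    and h: "\<And>x. x \<in> ball p r \<Longrightarrow> h differentiable (at x)"
    and dh: "\<And>x. x \<in> ball p r \<Longrightarrow> (\<lambda>q. frechet_derivative h (at q) u) differentiable (at x)"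
  obtains \<xi> where "\<xi> \<in> ball p r"
    "h (p + t *\<^sub>R u + t *\<^sub>R v) - h (p + t *\<^sub>R u) - h (p + t *\<^sub>R v) + h p
      = t * t * frechet_derivative (\<lambda>q. frechet_derivative h (at q) u) (at \<xi>) v"
proof -
  have inball: "p + s *\<^sub>R u + s' *\<^sub>R v \<in> ball p r" if "0 \<le> s" "s \<le> t" "0 \<le> s'" "s' \<le> t" for s s'
  proof -
    have "norm (s *\<^sub>R u + s' *\<^sub>R v) \<le> norm (s *\<^sub>R u) + norm (s' *\<^sub>R v)"
      by (rule norm_triangle_ineq)
    also have "\<dots> \<le> t * norm u + t * norm v"
      using that by (intro add_mono) (auto intro: mult_right_mono)
    also have "\<dots> < r" using t(2) by (simp add: distrib_left)
    finally have "norm (s *\<^sub>R u + s' *\<^sub>R v) < r" .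
    moreover have "dist p (p + s *\<^sub>R u + s' *\<^sub>R v) = norm (s *\<^sub>R u + s' *\<^sub>R v)"
      by (metis add.assoc add_diff_cancel_left' dist_commute dist_norm)
    ultimately show ?thesis by simp
  qed
  let ?w = "\<lambda>q. frechet_derivative h (at q) u"
  have "((\<lambda>s. h ((p + t *\<^sub>R v) + s *\<^sub>R u) - h (p + s *\<^sub>R u)) has_real_derivative
      ?w ((p + t *\<^sub>R v) + s *\<^sub>R u) - ?w (p + s *\<^sub>R u)) (at s)" if "0 \<le> s" "s \<le> t" for s
    using h inball[OF that, of t] inball[OF that, of 0] t(1)
    by (intro DERIV_diff has_real_derivative_along_line) (auto simp: algebra_simps)
  from MVT2[OF t(1) this] obtain s where s: "0 < s" "s < t" and eq1:
    "(h ((p + t *\<^sub>R v) + t *\<^sub>R u) - h (p + t *\<^sub>R u)) - (h ((p + t *\<^sub>R v) + 0 *\<^sub>R u) - h (p + 0 *\<^sub>R u))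
      = (t - 0) * (?w ((p + t *\<^sub>R v) + s *\<^sub>R u) - ?w (p + s *\<^sub>R u))"
    by blast
  have "((\<lambda>s'. ?w ((p + s *\<^sub>R u) + s' *\<^sub>R v)) has_real_derivative
      frechet_derivative ?w (at ((p + s *\<^sub>R u) + s' *\<^sub>R v)) v) (at s')" if "0 \<le> s'" "s' \<le> t" for s'
    using inball[of s s'] s that by (intro has_real_derivative_along_line dh) auto
  from MVT2[OF t(1) this] obtain s' where s': "0 < s'" "s' < t" and eq2:
    "?w ((p + s *\<^sub>R u) + t *\<^sub>R v) - ?w ((p + s *\<^sub>R u) + 0 *\<^sub>R v)
      = (t - 0) * frechet_derivative ?w (at ((p + s *\<^sub>R u) + s' *\<^sub>R v)) v"
    by blast
  show thesis
  proof (rule that)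
    show "p + s *\<^sub>R u + s' *\<^sub>R v \<in> ball p r"
      using inball s s' by simp
    show "h (p + t *\<^sub>R u + t *\<^sub>R v) - h (p + t *\<^sub>R u) - h (p + t *\<^sub>R v) + h p
      = t * t * frechet_derivative ?w (at (p + s *\<^sub>R u + s' *\<^sub>R v)) v"
      using eq1 eq2 by (simp add: algebra_simps)
  qed
qed

text \<open>The second difference over a parallelogram is symmetric in \<open>u\<close> and
  \<open>v\<close>, so both mixed derivatives take a common value at two points near
  \<open>p\<close>. Continuity of the mixed derivatives at \<open>p\<close> then brings their values
  at \<open>p\<close> within any \<epsilon> of each other.\<close>

lemma second_derivative_symmetric_real:
  fixes h :: "'a::euclidean_space \<Rightarrow> real"
  assumes U: "open U" "p \<in> U" and h: "smooth_on U h"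
  shows "frechet_derivative (\<lambda>q. frechet_derivative h (at q) u) (at p) v
    = frechet_derivative (\<lambda>q. frechet_derivative h (at q) v) (at p) u" (is "?H u v p = ?H v u p")
proof -
  have cont: "\<exists>r>0. ball p r \<subseteq> U \<and> (\<forall>x\<in>ball p r. \<bar>?H u v x - ?H u v p\<bar> < \<epsilon>)"
    if "\<epsilon> > 0" for u v and \<epsilon> :: real
  proof -
    have "smooth_on U (?H u v)"
      using h by (intro smooth_on_frechet_derivative)
    then have "isCont (?H u v) p"
      using smooth_on_differentiable U(2) differentiable_imp_continuous_within by blast
    then obtain d where "d > 0" "\<And>x. dist x p < d \<Longrightarrow> \<bar>?H u v x - ?H u v p\<bar> < \<epsilon>"
      using \<open>\<epsilon> > 0\<close> unfolding continuous_at_eps_delta dist_real_def by blast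
    moreover obtain d' where "d' > 0" "ball p d' \<subseteq> U"
      using U openE by blast
    ultimately show ?thesis
      by (intro exI[of _ "min d d'"]) (auto simp: dist_commute subset_eq)
  qed
  have "\<bar>?H u v p - ?H v u p\<bar> \<le> \<epsilon>" if "\<epsilon> > 0" for \<epsilon> :: real
  proof -
    obtain r1 where r1: "r1 > 0" "ball p r1 \<subseteq> U" "\<And>x. x \<in> ball p r1 \<Longrightarrow> \<bar>?H u v x - ?H u v p\<bar> < \<epsilon>/2"
      using cont[of "\<epsilon>/2" u v] \<open>\<epsilon> > 0\<close> by auto
    obtain r2 where r2: "r2 > 0" "ball p r2 \<subseteq> U" "\<And>x. x \<in> ball p r2 \<Longrightarrow> \<bar>?H v u x - ?H v u p\<bar> < \<epsilon>/2"
      using cont[of "\<epsilon>/2" v u] \<open>\<epsilon> > 0\<close> by auto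
    define r where "r = min r1 r2"
    \<comment> \<open>The summand 1 keeps the denominator positive when \<open>u\<close> and
      \<open>v\<close> are both 0, and makes the bound on \<open>t\<close> strict.\<close>
    define t where "t = r / (norm u + norm v + 1)"
    have r: "r > 0" "ball p r \<subseteq> U"
      using r1 r2 by (auto simp: r_def)
    have t: "t > 0" "t * (norm u + norm v) < r"
      using r norm_ge_zero[of u] norm_ge_zero[of v]
      by (auto simp: t_def divide_simps add_nonneg_pos intro!: mult_strict_left_mono)
    have diff: "h differentiable (at x)" "(\<lambda>q. frechet_derivative h (at q) w) differentiable (at x)"
      if "x \<in> ball p r" for x w
      using that r(2) h smooth_on_frechet_derivative[OF h] smooth_on_differentiable by blast+
    obtain \<xi> where \<xi>: "\<xi> \<in> ball p r" "h (p + t *\<^sub>R u + t *\<^sub>R v) - h (p + t *\<^sub>R u) - h (p + t *\<^sub>R v) + h p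
        = t * t * ?H u v \<xi>"
      using second_difference_mvt[OF t, of p h] diff by blast
    have t': "t * (norm v + norm u) < r"
      using t by (simp add: add.commute)
    obtain \<zeta> where \<zeta>: "\<zeta> \<in> ball p r" "h (p + t *\<^sub>R v + t *\<^sub>R u) - h (p + t *\<^sub>R v) - h (p + t *\<^sub>R u) + h p
        = t * t * ?H v u \<zeta>"
      using second_difference_mvt[OF t(1) t', of p h] diff by blast
    have "p + t *\<^sub>R v + t *\<^sub>R u = p + t *\<^sub>R u + t *\<^sub>R v"
      by (simp add: algebra_simps)
    from \<zeta>(2)[unfolded this] \<xi>(2) have "t * t * ?H u v \<xi> = t * t * ?H v u \<zeta>"
      by linarith
    then have "?H u v \<xi> = ?H v u \<zeta>"
      using t(1) by simp
    moreover have "\<bar>?H u v \<xi> - ?H u v p\<bar> < \<epsilon>/2" "\<bar>?H v u \<zeta> - ?H v u p\<bar> < \<epsilon>/2"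
      using r1(3) r2(3) \<xi>(1) \<zeta>(1) by (simp_all add: r_def)
    ultimately show ?thesis
      unfolding abs_le_iff abs_less_iff by linarith
  qed
  then show ?thesis
    using field_le_epsilon[of "\<bar>?H u v p - ?H v u p\<bar>" 0] by simp
qed

text \<open>Inner products with basis vectors commute with differentiation, which reduces the claim
  to the real-valued case.\<close>

lemma second_derivative_symmetric:
  fixes h :: "'a::euclidean_space \<Rightarrow> 'b::euclidean_space"
  assumes U: "open U" "p \<in> U" and h: "smooth_on U h"
  shows "frechet_derivative (\<lambda>q. frechet_derivative h (at q) u) (at p) v
    = frechet_derivative (\<lambda>q. frechet_derivative h (at q) v) (at p) u"
proof (rule euclidean_eqI)
  fix b :: 'b
  assume "b \<in> Basis"
  have comp: "frechet_derivative (\<lambda>x. k x \<bullet> b) (at x) w = frechet_derivative k (at x) w \<bullet> b"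
    if "smooth_on U k" "x \<in> U" for k :: "'a \<Rightarrow> 'b" and x w
    using frechet_derivative_at[OF has_derivative_inner_left[OF smooth_on_has_derivative[OF that]]]
    by metis
  have "frechet_derivative (\<lambda>q. frechet_derivative (\<lambda>x. h x \<bullet> b) (at q) u) (at p) v
      = frechet_derivative (\<lambda>q. frechet_derivative h (at q) u) (at p) v \<bullet> b" for u v
  proof -
    have "frechet_derivative (\<lambda>q. frechet_derivative (\<lambda>x. h x \<bullet> b) (at q) u) (at p)
        = frechet_derivative (\<lambda>q. frechet_derivative h (at q) u \<bullet> b) (at p)"
      by (rule frechet_derivative_cong_open[OF U]) (rule comp[OF h])
    then show ?thesis
      using comp[OF smooth_on_frechet_derivative[OF h] \<open>p \<in> U\<close>] by simp
  qed
  then show "frechet_derivative (\<lambda>q. frechet_derivative h (at q) u) (at p) v \<bullet> b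
    = frechet_derivative (\<lambda>q. frechet_derivative h (at q) v) (at p) u \<bullet> b"
    using second_derivative_symmetric_real[OF U smooth_on_bounded_linear[OF U(1) bounded_linear_inner_left h]]
    by metis
qed

subsection \<open>Affine and Levi-Civita connections\<close>

lemma
  assumes "affine_connection_on U D" "smooth_on U X" "smooth_on U Y"
  shows affine_connection_smooth: "smooth_on U (D X Y)"
    and affine_connection_add_left: "smooth_on U X' \<Longrightarrow> p \<in> U \<Longrightarrow>
      D (\<lambda>q. X q + X' q) Y p = D X Y p + D X' Y p"
    and affine_connection_scale_left: "smooth_on U h \<Longrightarrow> p \<in> U \<Longrightarrow>
      D (\<lambda>q. h q *\<^sub>R X q) Y p = h p *\<^sub>R D X Y p"
    and affine_connection_add_right: "smooth_on U Y' \<Longrightarrow> p \<in> U \<Longrightarrow>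
      D X (\<lambda>q. Y q + Y' q) p = D X Y p + D X Y' p"
    and affine_connection_leibniz: "smooth_on U h \<Longrightarrow> p \<in> U \<Longrightarrow>
      D X (\<lambda>q. h q *\<^sub>R Y q) p = vderiv X h p *\<^sub>R Y p + h p *\<^sub>R D X Y p"
proof -
  note D = assms(1)[unfolded affine_connection_on_def]
  show "smooth_on U (D X Y)"
    using D[THEN conjunct1, rule_format, OF assms(2,3)] .
  show "D (\<lambda>q. X q + X' q) Y p = D X Y p + D X' Y p" if "smooth_on U X'" "p \<in> U"
    using D[THEN conjunct2, THEN conjunct1, rule_format, OF assms(2) that(1) assms(3) that(2)] .
  show "D (\<lambda>q. h q *\<^sub>R X q) Y p = h p *\<^sub>R D X Y p" if "smooth_on U h" "p \<in> U"
    using D[THEN conjunct2, THEN conjunct2, THEN conjunct1, rule_format, OF that(1) assms(2,3) that(2)] .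
  show "D X (\<lambda>q. Y q + Y' q) p = D X Y p + D X Y' p" if "smooth_on U Y'" "p \<in> U"
    using D[THEN conjunct2, THEN conjunct2, THEN conjunct2, THEN conjunct1, rule_format,
        OF assms(2,3) that] .
  show "D X (\<lambda>q. h q *\<^sub>R Y q) p = vderiv X h p *\<^sub>R Y p + h p *\<^sub>R D X Y p"
    if "smooth_on U h" "p \<in> U"
    using D[THEN conjunct2, THEN conjunct2, THEN conjunct2, THEN conjunct2, rule_format,
        OF that(1) assms(2,3) that(2)] .
qed

text \<open>Locality uses the function that vanishes on \<open>U\<close> and equals 1 elsewhere, which is smooth on \<open>U\<close>:
  it annihilates, on \<open>U\<close>, the difference of two fields that agree there.\<close>

lemma smooth_on_indicator_compl: "open U \<Longrightarrow> smooth_on U (indicat_real (- U))"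
  by (rule smooth_on_cong[OF _ _ smooth_on_const[of U 0]]) auto

lemma affine_connection_cong_left:
  assumes D: "affine_connection_on U D" and "open U" and X: "smooth_on U X" and Y: "smooth_on U Y"
    and eq: "\<And>q. q \<in> U \<Longrightarrow> X q = X' q" and p: "p \<in> U"
  shows "D X Y p = D X' Y p"
proof -
  let ?\<chi> = "indicat_real (- U)" and ?W = "\<lambda>q. X' q - X q"
  have X': "X' = (\<lambda>q. X q + ?\<chi> q *\<^sub>R ?W q)"
    using eq by (auto simp: fun_eq_iff indicator_def)
  have W: "smooth_on U ?W"
    using smooth_on_diff[OF \<open>open U\<close> smooth_on_cong[OF \<open>open U\<close> eq X] X] .
  have "smooth_on U (\<lambda>q. ?\<chi> q *\<^sub>R ?W q)"
    by (rule smooth_on_cong[OF \<open>open U\<close> _ smooth_on_const[of U 0]]) auto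
  from affine_connection_add_left[OF D X Y this p]
    affine_connection_scale_left[OF D W Y smooth_on_indicator_compl[OF \<open>open U\<close>] p] p
  show ?thesis by (subst X') simp
qed

lemma affine_connection_cong_right:
  assumes D: "affine_connection_on U D" and "open U" and X: "smooth_on U X" and Y: "smooth_on U Y"
    and eq: "\<And>q. q \<in> U \<Longrightarrow> Y q = Y' q" and p: "p \<in> U"
  shows "D X Y p = D X Y' p"
proof -
  let ?\<chi> = "indicat_real (- U)" and ?W = "\<lambda>q. Y' q - Y q"
  have Y': "Y' = (\<lambda>q. Y q + ?\<chi> q *\<^sub>R ?W q)"
    using eq by (auto simp: fun_eq_iff indicator_def)
  have W: "smooth_on U ?W"
    using smooth_on_diff[OF \<open>open U\<close> smooth_on_cong[OF \<open>open U\<close> eq Y] Y] .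
  \<comment> \<open>Unlike the first argument, the second obeys the Leibniz rule, whose extra term
    is a multiple of \<open>?W p\<close>; this fact removes it.\<close>
  have "?W p = 0"
    using eq p by simp
  have "smooth_on U (\<lambda>q. ?\<chi> q *\<^sub>R ?W q)"
    by (rule smooth_on_cong[OF \<open>open U\<close> _ smooth_on_const[of U 0]]) auto
  from affine_connection_add_right[OF D X Y this p]
    affine_connection_leibniz[OF D X W smooth_on_indicator_compl[OF \<open>open U\<close>] p] p \<open>?W p = 0\<close>
  show ?thesis by (subst Y') simp
qed

lemma
  assumes "levi_civita_on U g D" "smooth_on U X" "smooth_on U Y" "p \<in> U"
  shows levi_civita_torsion_free: "D X Y p - D Y X p = lie_bracket X Y p"
    and levi_civita_metric: "smooth_on U Z \<Longrightarrow>
      vderiv X (\<lambda>q. g q (Y q) (Z q)) p = g p (D X Y p) (Z p) + g p (Y p) (D X Z p)"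
  using assms unfolding levi_civita_on_def by blast+

lemma levi_civita_affine: "levi_civita_on U g D \<Longrightarrow> affine_connection_on U D"
  by (simp add: levi_civita_on_def)

text \<open>Torsion-freeness makes the bracket a difference of covariant derivatives, whose
  smoothness is part of being an affine connection.\<close>

lemma levi_civita_smooth_lie_bracket:
  assumes LC: "levi_civita_on U g D" and "open U" and "smooth_on U X" "smooth_on U Y"
  shows "smooth_on U (lie_bracket X Y)"
proof (rule smooth_on_cong[OF \<open>open U\<close>])
  show "smooth_on U (\<lambda>p. D X Y p - D Y X p)"
    using assms affine_connection_smooth[OF levi_civita_affine[OF LC]] by (intro smooth_on_diff) auto
qed (use assms levi_civita_torsion_free in blast)

text \<open>Metric compatibility is added for \<open>X\<close> and \<open>Y\<close> and subtracted
  for \<open>Z\<close>; torsion-freeness turns the brackets into differences of covariant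
  derivatives, and all terms but two equal ones cancel by symmetry.\<close>

lemma koszul_formula:
  assumes LC: "levi_civita_on U g D" and X: "smooth_on U X" and Y: "smooth_on U Y"
    and Z: "smooth_on U Z" and p: "p \<in> U"
    and diff: "\<And>u v w. g p (u - v) w = g p u w - g p v w" and sym: "\<And>u v. g p u v = g p v u"
  shows "2 * g p (D X Y p) (Z p) = vderiv X (\<lambda>q. g q (Y q) (Z q)) p + vderiv Y (\<lambda>q. g q (X q) (Z q)) p
    - vderiv Z (\<lambda>q. g q (X q) (Y q)) p + g p (lie_bracket X Y p) (Z p)
    - g p (lie_bracket X Z p) (Y p) - g p (lie_bracket Y Z p) (X p)"
  unfolding levi_civita_metric[OF LC X Y p Z] levi_civita_metric[OF LC Y X p Z]
    levi_civita_metric[OF LC Z X p Y] levi_civita_torsion_free[OF LC X Y p, symmetric]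
    levi_civita_torsion_free[OF LC X Z p, symmetric] levi_civita_torsion_free[OF LC Y Z p, symmetric] diff
  using sym[of "X p"] sym[of "Y p"] by simp

text \<open>Expanding \<open>Y q\<close> in the standard basis makes the expression a sum of scalar
  functions times vector fields, to which the product rule applies. Symmetry of second derivatives
  then allows the basis sum to be reassembled with \<open>w\<close> as the inner direction.\<close>

lemma frechet_derivative_directional:
  fixes Z :: "'a::euclidean_space \<Rightarrow> 'b::euclidean_space"
  assumes U: "open U" "p \<in> U" and Y: "smooth_on U Y" and Z: "smooth_on U Z"
  shows "frechet_derivative (\<lambda>q. frechet_derivative Z (at q) (Y q)) (at p) w
    = frechet_derivative Z (at p) (frechet_derivative Y (at p) w)
      + frechet_derivative (\<lambda>q. frechet_derivative Z (at q) w) (at p) (Y p)"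
proof -
  let ?d = "\<lambda>q b. frechet_derivative Z (at q) b"
  have lin: "linear (?d q)" if "q \<in> U" for q
    using linear_frechet_derivative smooth_on_differentiable[OF Z that] by blast
  have expand: "L v = (\<Sum>b\<in>Basis. (v \<bullet> b) *\<^sub>R L b)" if "linear L" for L :: "'a \<Rightarrow> 'b" and v
    using linear_sum[OF that, of "\<lambda>b. (v \<bullet> b) *\<^sub>R b" Basis] linear_cmul[OF that]
    by (simp add: euclidean_representation)
  have "((\<lambda>q. \<Sum>b\<in>Basis. (Y q \<bullet> b) *\<^sub>R ?d q b) has_derivative (\<lambda>w. \<Sum>b\<in>Basis.
      (Y p \<bullet> b) *\<^sub>R frechet_derivative (\<lambda>q. ?d q b) (at p) w
      + (frechet_derivative Y (at p) w \<bullet> b) *\<^sub>R ?d p b)) (at p)"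
    by (intro has_derivative_sum has_derivative_scaleR has_derivative_inner_left
        smooth_on_has_derivative[OF _ U(2)] smooth_on_frechet_derivative Y Z)
  note D = frechet_derivative_at[OF this, symmetric]
  have "frechet_derivative (\<lambda>q. \<Sum>b\<in>Basis. (Y q \<bullet> b) *\<^sub>R ?d q b) (at p) w
      = (\<Sum>b\<in>Basis. (Y p \<bullet> b) *\<^sub>R frechet_derivative (\<lambda>q. ?d q b) (at p) w)
      + (\<Sum>b\<in>Basis. (frechet_derivative Y (at p) w \<bullet> b) *\<^sub>R ?d p b)"
    unfolding D by (rule sum.distrib)
  also have "frechet_derivative (\<lambda>q. \<Sum>b\<in>Basis. (Y q \<bullet> b) *\<^sub>R ?d q b) (at p)
      = frechet_derivative (\<lambda>q. ?d q (Y q)) (at p)"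
    by (rule frechet_derivative_cong_open[OF U]) (rule expand[OF lin, symmetric])
  also have "(\<Sum>b\<in>Basis. (frechet_derivative Y (at p) w \<bullet> b) *\<^sub>R ?d p b)
      = ?d p (frechet_derivative Y (at p) w)"
    by (rule expand[OF lin[OF U(2)], symmetric])
  also have "(\<Sum>b\<in>Basis. (Y p \<bullet> b) *\<^sub>R frechet_derivative (\<lambda>q. ?d q b) (at p) w)
      = (\<Sum>b\<in>Basis. (Y p \<bullet> b) *\<^sub>R frechet_derivative (\<lambda>q. ?d q w) (at p) b)"
    by (intro sum.cong refl arg_cong2[where f = scaleR] second_derivative_symmetric[OF U Z])
  also have "\<dots> = frechet_derivative (\<lambda>q. ?d q w) (at p) (Y p)"
    using smooth_on_differentiable[OF smooth_on_frechet_derivative[OF Z] U(2)]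
    by (intro expand[symmetric] linear_frechet_derivative)
  finally show ?thesis by simp
qed

subsection \<open>Metrics with constant coefficients\<close>

locale constant_metric =
  fixes U :: "'a::euclidean_space set" and g :: "'a tensor2" and B :: "'a \<Rightarrow> 'a \<Rightarrow> real"
  assumes open_U: "open U" and bilinear: "bounded_bilinear B" and sym: "\<And>u v. B u v = B v u"
    and nondegenerate: "\<And>u. (\<And>w. B u w = 0) \<Longrightarrow> u = 0"
    and g_eq: "\<And>p. p \<in> U \<Longrightarrow> g p = B"
begin

lemma vderiv_metric:
  assumes Y: "smooth_on U Y" and Z: "smooth_on U Z" and p: "p \<in> U"
  shows "vderiv X (\<lambda>q. g q (Y q) (Z q)) p
    = B (frechet_derivative Y (at p) (X p)) (Z p) + B (Y p) (frechet_derivative Z (at p) (X p))"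
proof -
  have "frechet_derivative (\<lambda>q. g q (Y q) (Z q)) (at p) = frechet_derivative (\<lambda>q. B (Y q) (Z q)) (at p)"
    by (rule frechet_derivative_cong_open[OF open_U p]) (simp add: g_eq)
  also have "\<dots> = (\<lambda>w. B (Y p) (frechet_derivative Z (at p) w) + B (frechet_derivative Y (at p) w) (Z p))"
    by (rule frechet_derivative_at[symmetric], rule bounded_bilinear.FDERIV[OF bilinear];
        rule smooth_on_has_derivative[OF _ p]; fact)
  finally show ?thesis by (simp add: vderiv_def)
qed

text \<open>In Koszul's formula with a constant third field \<open>w\<close>, the brackets with
  \<open>w\<close> reduce to derivatives of \<open>X\<close> and \<open>Y\<close> along
  \<open>w\<close>, which cancel. What is left is the pairing with \<open>w\<close>, and
  nondegeneracy removes \<open>w\<close>.\<close>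

lemma levi_civita_eq_frechet_derivative:
  assumes LC: "levi_civita_on U g D" and X: "smooth_on U X" and Y: "smooth_on U Y" and p: "p \<in> U"
  shows "D X Y p = frechet_derivative Y (at p) (X p)"
proof -
  interpret B: bounded_bilinear B by (rule bilinear)
  have "B (D X Y p - frechet_derivative Y (at p) (X p)) w = 0" for w
  proof -
    have w: "smooth_on U (\<lambda>_. w)" by (rule smooth_on_const)
    have "g p (u - v) w = g p u w - g p v w" "g p u v = g p v u" for u v w
      unfolding g_eq[OF p] by (rule B.diff_left sym)+
    note koszul_formula[OF LC X Y w p this, unfolded vderiv_metric[OF Y w p, of X]
        vderiv_metric[OF X w p, of Y] vderiv_metric[OF X Y p, of "\<lambda>_. w"] g_eq[OF p] lie_bracket_def
        frechet_derivative_const B.diff_left B.zero_right B.zero_left]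
    then show ?thesis
      using sym[of "X p" "frechet_derivative Y (at p) w"] unfolding B.diff_left by linarith
  qed
  from nondegenerate[OF this] show ?thesis by simp
qed

lemma flat:
  assumes LC: "levi_civita_on U g D"
  shows "flat_on U D"
  unfolding flat_on_def
proof (intro allI impI ballI)
  fix X Y Z :: "'a vfield" and p
  assume X: "smooth_on U X" and Y: "smooth_on U Y" and Z: "smooth_on U Z" and p: "p \<in> U"
  \<comment> \<open>The vector \<open>X p\<close> is frozen in the last summand, which is therefore
    a pure second derivative of \<open>Z\<close> and symmetric in \<open>X p\<close> and
    \<open>Y p\<close>. In the curvature it cancels, and the first summands combine to the
    derivative of \<open>Z\<close> along the bracket.\<close>
  have second: "D X (D Y Z) p = frechet_derivative Z (at p) (frechet_derivative Y (at p) (X p))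
      + frechet_derivative (\<lambda>q. frechet_derivative Z (at q) (X p)) (at p) (Y p)"
    if X: "smooth_on U X" and Y: "smooth_on U Y" for X Y
  proof -
    have "D X (D Y Z) p = frechet_derivative (D Y Z) (at p) (X p)"
      using levi_civita_eq_frechet_derivative[OF LC X _ p]
        affine_connection_smooth[OF levi_civita_affine[OF LC] Y Z] by blast
    also have "frechet_derivative (D Y Z) (at p)
        = frechet_derivative (\<lambda>q. frechet_derivative Z (at q) (Y q)) (at p)"
      by (rule frechet_derivative_cong_open[OF open_U p])
        (rule levi_civita_eq_frechet_derivative[OF LC Y Z])
    finally show ?thesis
      by (simp add: frechet_derivative_directional[OF open_U p Y Z])
  qed
  have "linear (frechet_derivative Z (at p))"
    by (intro linear_frechet_derivative smooth_on_differentiable[OF Z p])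
  then show "curvature D X Y Z p = 0"
    using levi_civita_eq_frechet_derivative[OF LC levi_civita_smooth_lie_bracket[OF LC open_U X Y] Z p]
      second_derivative_symmetric[OF open_U p Z, of "X p" "Y p"]
    by (simp add: curvature_def second[OF X Y] second[OF Y X] lie_bracket_def linear_diff)
qed

lemma killing_const:
  assumes V: "\<And>p. p \<in> U \<Longrightarrow> V p = v"
  shows "killing_on U g V"
proof -
  have "lie_deriv_metric g V Y Z p = 0" if Y: "smooth_on U Y" and Z: "smooth_on U Z" and p: "p \<in> U" for Y Z p
  proof -
    \<comment> \<open>Hence the bracket of \<open>V\<close> with \<open>Y\<close> is the derivative
      of \<open>Y\<close> along \<open>V\<close>, and the Lie derivative cancels against the product
      rule for \<open>B\<close>.\<close>
    have "frechet_derivative V (at p) = (\<lambda>_. 0)"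
      using frechet_derivative_cong_open[OF open_U p V] by simp
    then show ?thesis
      by (simp add: lie_deriv_metric_def vderiv_metric[OF Y Z p] lie_bracket_def g_eq p)
  qed
  moreover have "smooth_on U V"
    by (rule smooth_on_cong[OF open_U _ smooth_on_const[of U v]]) (simp add: V)
  ultimately show ?thesis by (simp add: killing_on_def)
qed

end

subsection \<open>Diagonal metrics depending on the third coordinate\<close>

text \<open>Nothing is assumed about the regularity of \<open>h\<close>: its derivative comes from
  restricting \<phi> to the line through \<open>p\<close> in direction \<open>axis k 1\<close>. The
  chain rule then gives the derivative of \<phi> in every direction.\<close>

lemma
  fixes \<phi> :: "real^'n \<Rightarrow> real"
  assumes U: "open U" "p \<in> U" and h: "\<And>q. q \<in> U \<Longrightarrow> \<phi> q = h (q $ k)" and diff: "\<phi> differentiable (at p)"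
  shows coordinate_function_has_derivative:
      "(h has_real_derivative frechet_derivative \<phi> (at p) (axis k 1)) (at (p $ k))" (is ?der)
    and coordinate_function_frechet_derivative:
      "frechet_derivative \<phi> (at p) v = v $ k * frechet_derivative \<phi> (at p) (axis k 1)" (is ?fr)
proof -
  let ?l = "\<lambda>s. p + s *\<^sub>R axis k 1" and ?d = "frechet_derivative \<phi> (at p) (axis k 1)"
  have "((\<lambda>s. \<phi> (?l s)) has_real_derivative ?d) (at 0)"
    using has_real_derivative_along_line[of \<phi> p 0 "axis k 1"] diff by simp
  \<comment> \<open>For \<open>s\<close> near 0 the line stays in \<open>U\<close>, where \<phi> may
    be replaced by \<open>h\<close> of the coordinate.\<close>
  moreover have "open (?l -` U)"
    by (intro open_vimage U continuous_intros)
  ultimately have "((\<lambda>s. h (s + p $ k)) has_real_derivative ?d) (at 0)"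
    by (rule has_field_derivative_transform_within_open) (use h U(2) in \<open>auto simp: add.commute\<close>)
  then show der: ?der
    using DERIV_shift[of h ?d 0 "p $ k"] by simp
  have "((\<lambda>q. h (q $ k)) has_derivative (\<lambda>v. ?d * v $ k)) (at p)"
    using has_derivative_compose[OF bounded_linear.has_derivative[OF bounded_linear_vec_nth has_derivative_ident]
        der[unfolded has_field_derivative_def]] .
  then have "(\<phi> has_derivative (\<lambda>v. ?d * v $ k)) (at p)"
    by (rule has_derivative_transform_within_open[OF _ U]) (simp add: h)
  from frechet_derivative_at[OF this, symmetric] show ?fr
    unfolding mult.commute[of "v $ k"] by (rule fun_cong)
qed

locale diagonal_metric =
  fixes U :: "(real^3) set" and f1 f2 :: "real^3 \<Rightarrow> real" and D :: "(real^3) connection"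
  assumes open_U: "open U"
    and f1_smooth: "smooth_on U f1" and f1_nz: "\<And>p. p \<in> U \<Longrightarrow> f1 p \<noteq> 0"
    and f2_smooth: "smooth_on U f2" and f2_nz: "\<And>p. p \<in> U \<Longrightarrow> f2 p \<noteq> 0"
    and f1_x3: "\<exists>h. \<forall>p\<in>U. f1 p = h (p $ 3)" and f2_x3: "\<exists>h. \<forall>p\<in>U. f2 p = h (p $ 3)"
    and LC: "levi_civita_on U (g_tilde f1 f2) D"
begin

abbreviation "g \<equiv> g_tilde f1 f2"
abbreviation "E \<equiv> frame3 f1 f2"

text \<open>The value 1 at index 3 lets all three frame fields be treated uniformly as
  \<open>F k\<close> times a coordinate field.\<close>

definition F :: "3 \<Rightarrow> real^3 \<Rightarrow> real" where
  "F k = (if k = 1 then f1 else if k = 2 then f2 else (\<lambda>_. 1))"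

text \<open>Logarithmic derivative along the third coordinate: \<open>c 1\<close> and
  \<open>c 2\<close> are the \<open>a\<close> and \<open>b\<close> of the outline.\<close>

definition c :: "3 \<Rightarrow> real^3 \<Rightarrow> real" where
  "c k p = frechet_derivative (F k) (at p) (axis 3 1) / F k p"

definition c' :: "3 \<Rightarrow> real^3 \<Rightarrow> real" where
  "c' k p = frechet_derivative (c k) (at p) (axis 3 1)"

lemma F_simps [simp]: "F 1 = f1" "F 2 = f2" "F 3 = (\<lambda>_. 1)"
  by (simp_all add: F_def)

lemma F_smooth: "smooth_on U (F k)"
  by (simp add: F_def f1_smooth f2_smooth smooth_on_const)

lemma F_nz: "p \<in> U \<Longrightarrow> F k p \<noteq> 0"
  by (simp add: F_def f1_nz f2_nz)

lemma F_x3: "\<exists>h. \<forall>p\<in>U. F k p = h (p $ 3)"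
proof (cases "k = 1 \<or> k = 2")
  case True
  then show ?thesis using f1_x3 f2_x3 by (elim disjE) simp_all
next
  case False
  then show ?thesis by (intro exI[of _ "\<lambda>_. 1"]) (simp add: F_def)
qed

lemma E_eq: "E k p = F k p *\<^sub>R axis k 1"
  using exhaust_3[of k] by (auto simp: frame3_def F_def)

lemma E_smooth: "smooth_on U (E k)"
  unfolding E_eq by (rule smooth_on_bounded_linear[OF open_U bounded_linear_scaleR_left F_smooth])

lemma E_nth_3: "E k p $ 3 = of_bool (k = 3)"
  by (auto simp: E_eq axis_def)

lemma g_diff: "g p (u - v) w = g p u w - g p v w"
  and g_add: "g p (u + v) w = g p u w + g p v w"
  and g_scale: "g p (r *\<^sub>R u) w = r * g p u w"
  and g_zero: "g p 0 w = 0"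
  and g_sym: "g p u v = g p v u"
  by (auto simp: g_tilde_def algebra_simps)

lemma g_E: "p \<in> U \<Longrightarrow> g p u (E k p) = u $ k / F k p"
  using exhaust_3[of k] f1_nz[of p] f2_nz[of p]
  by (auto simp: g_tilde_def E_eq axis_def power2_eq_square)

lemma g_E_E: "p \<in> U \<Longrightarrow> g p (E j p) (E k p) = of_bool (j = k)"
  using frame3_orthonormal[of f1 p f2 j k] f1_nz f2_nz by simp

lemma g_eqI: "p \<in> U \<Longrightarrow> (\<And>k. g p u (E k p) = g p v (E k p)) \<Longrightarrow> u = v"
  using F_nz by (simp add: g_E vec_eq_iff)

lemma c_3 [simp]: "c 3 p = 0"
  by (simp add: c_def)

lemma F_frechet_derivative:
  assumes "p \<in> U"
  shows "frechet_derivative (F k) (at p) v = v $ 3 * (c k p * F k p)"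
proof -
  obtain h where "\<And>q. q \<in> U \<Longrightarrow> F k q = h (q $ 3)"
    using F_x3 by blast
  note deriv = coordinate_function_frechet_derivative[OF open_U assms this
      smooth_on_differentiable[OF F_smooth assms]]
  have "c k p * F k p = frechet_derivative (F k) (at p) (axis 3 1)"
    using F_nz[OF assms] by (simp add: c_def)
  then show ?thesis by (simp only: deriv[of v])
qed

lemma E_frechet_derivative:
  assumes "p \<in> U"
  shows "frechet_derivative (E k) (at p) v = (v $ 3 * c k p) *\<^sub>R E k p"
proof -
  have "(E k has_derivative (\<lambda>v. frechet_derivative (F k) (at p) v *\<^sub>R axis k 1)) (at p)"
    unfolding E_eq by (intro has_derivative_scaleR_left smooth_on_has_derivative[OF F_smooth assms])
  from frechet_derivative_at[OF this, symmetric] show ?thesis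
    by (simp add: F_frechet_derivative[OF assms] E_eq mult.assoc)
qed

section \<open>Brackets and connection coefficients of the orthonormal frame\<close>

lemma lie_bracket_E:
  "p \<in> U \<Longrightarrow> lie_bracket (E i) (E j) p
    = (of_bool (i = 3) * c j p) *\<^sub>R E j p - (of_bool (j = 3) * c i p) *\<^sub>R E i p"
  by (simp only: lie_bracket_def E_frechet_derivative E_nth_3)

lemma vderiv_g_E:
  assumes "p \<in> U"
  shows "vderiv X (\<lambda>q. g q (E i q) (E j q)) p = 0"
proof -
  have "frechet_derivative (\<lambda>q. g q (E i q) (E j q)) (at p) = frechet_derivative (\<lambda>_. of_bool (i = j)) (at p)"
    by (rule frechet_derivative_cong_open[OF open_U assms]) (rule g_E_E)
  then show ?thesis by (simp add: vderiv_def)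
qed

text \<open>Inner products of frame fields are constant, so only the bracket terms of Koszul's
  formula survive; the case split evaluates the resulting Kronecker deltas. Since \<open>c 3\<close>
  vanishes, every derivative along \<open>E 3\<close> of a frame field is zero.\<close>

lemma connection_E:
  assumes p: "p \<in> U"
  shows "D (E i) (E j) p = (of_bool (i = j) * c i p) *\<^sub>R E 3 p - (of_bool (j = 3) * c i p) *\<^sub>R E i p"
proof (rule g_eqI[OF p])
  fix k
  show "g p (D (E i) (E j) p) (E k p)
    = g p ((of_bool (i = j) * c i p) *\<^sub>R E 3 p - (of_bool (j = 3) * c i p) *\<^sub>R E i p) (E k p)"
    using koszul_formula[OF LC E_smooth[of i] E_smooth[of j] E_smooth[of k] p g_diff g_sym]
    unfolding vderiv_g_E[OF p] lie_bracket_E[OF p] g_diff g_scale g_E_E[OF p]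
    by (cases "i = 3"; cases "j = 3"; cases "k = 3"; cases "i = j"; cases "j = k"; cases "i = k"; simp)
qed

lemma D_affine: "affine_connection_on U D"
  by (rule levi_civita_affine[OF LC])

text \<open>Smoothness of \<open>c k\<close> is inherited from that of the covariant derivative in which it is a coefficient.\<close>

lemma c_smooth: "smooth_on U (c k)"
proof (cases "k = 3")
  case True
  have "c 3 = (\<lambda>_. 0)"
    by (rule ext) simp
  with True show ?thesis by (simp only: smooth_on_const)
next
  case False
  show ?thesis
    by (rule smooth_on_cong[OF open_U _ smooth_on_bounded_linear[OF open_U bounded_linear_vec_nth
            affine_connection_smooth[OF D_affine E_smooth[of k] E_smooth[of k]], of 3]])
      (use False in \<open>simp add: connection_E E_nth_3\<close>)
qed

text \<open>If \<open>F k\<close> is \<open>h\<close> of the third coordinate, then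
  \<open>c k\<close> is \<open>h'/h\<close> of it. This permits a second use of the coordinate
  lemma, now for \<open>c k\<close>.\<close>

lemma c_x3: "\<exists>h. \<forall>p\<in>U. c k p = h (p $ 3)"
proof -
  obtain h where h: "\<And>q. q \<in> U \<Longrightarrow> F k q = h (q $ 3)"
    using F_x3 by blast
  have "c k p = deriv h (p $ 3) / h (p $ 3)" if "p \<in> U" for p
    using DERIV_imp_deriv[OF coordinate_function_has_derivative[OF open_U that h
          smooth_on_differentiable[OF F_smooth that]]] h[OF that]
    by (simp add: c_def)
  then show ?thesis by (intro exI[of _ "\<lambda>t. deriv h t / h t"]) simp
qed

lemma c_frechet_derivative:
  assumes "p \<in> U"
  shows "frechet_derivative (c k) (at p) v = v $ 3 * c' k p"
proof -
  obtain h where "\<And>q. q \<in> U \<Longrightarrow> c k q = h (q $ 3)"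
    using c_x3 by blast
  from coordinate_function_frechet_derivative[OF open_U assms this smooth_on_differentiable[OF c_smooth assms]]
  show ?thesis unfolding c'_def .
qed

section \<open>Curvature and Lie derivative in the frame\<close>

lemma connection_scale_E:
  assumes p: "p \<in> U"
  shows "D (E k) (\<lambda>q. (r * c i q) *\<^sub>R E m q) p
    = (r * of_bool (k = 3) * c' i p) *\<^sub>R E m p + (r * c i p) *\<^sub>R D (E k) (E m) p"
proof -
  have c: "smooth_on U (\<lambda>q. r * c i q)"
    by (rule smooth_on_bounded_linear[OF open_U bounded_linear_mult_right c_smooth])
  have "((\<lambda>q. r * c i q) has_derivative (\<lambda>v. r * frechet_derivative (c i) (at p) v)) (at p)"
    by (intro has_derivative_mult_right smooth_on_has_derivative[OF c_smooth p])
  from frechet_derivative_at[OF this, symmetric]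
  have "vderiv (E k) (\<lambda>q. r * c i q) p = r * of_bool (k = 3) * c' i p"
    by (simp add: vderiv_def c_frechet_derivative[OF p] E_nth_3)
  with affine_connection_leibniz[OF D_affine E_smooth E_smooth c p] show ?thesis
    by simp
qed

lemma connection_connection_E:
  assumes p: "p \<in> U"
  shows "D (E k) (D (E i) (E j)) p
    = (if j = 3 then - ((of_bool (k = 3) * c' i p) *\<^sub>R E i p + c i p *\<^sub>R D (E k) (E i) p)
       else of_bool (i = j) *\<^sub>R ((of_bool (k = 3) * c' i p) *\<^sub>R E 3 p + c i p *\<^sub>R D (E k) (E 3) p))"
proof -
  \<comment> \<open>Each \<open>D (E i) (E j)\<close> is a single term \<open>r * c i\<close> times
    \<open>E m\<close>. For \<open>i = j = 3\<close> this is consistent because \<open>c 3\<close>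
    is 0. The identity is needed on all of \<open>U\<close>, since the field is differentiated once
    more.\<close>
  define r m where "r = (if j = 3 then - 1 else of_bool (i = j) :: real)" and "m = (if j = 3 then i else 3)"
  have "D (E k) (D (E i) (E j)) p = D (E k) (\<lambda>q. (r * c i q) *\<^sub>R E m q) p"
  proof (rule affine_connection_cong_right[OF D_affine open_U E_smooth _ _ p])
    show "smooth_on U (D (E i) (E j))"
      by (intro affine_connection_smooth[OF D_affine] E_smooth)
    show "D (E i) (E j) q = (r * c i q) *\<^sub>R E m q" if "q \<in> U" for q
      by (auto simp: connection_E[OF that] r_def m_def)
  qed
  then show ?thesis
    unfolding connection_scale_E[OF p] by (simp add: r_def m_def)
qed

lemma connection_lie_bracket_E:
  assumes p: "p \<in> U"
  shows "D (lie_bracket (E k) (E i)) (E j) p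
    = (of_bool (k = 3) * c i p) *\<^sub>R D (E i) (E j) p - (of_bool (i = 3) * c k p) *\<^sub>R D (E k) (E j) p"
proof -
  \<comment> \<open>Brackets of frame fields also have at most one nonzero term, so one scaling law
    for the first argument of \<open>D\<close> suffices.\<close>
  define r m where "r = (if k = 3 then 1 else - of_bool (i = 3) :: real)" and "m = (if k = 3 then i else k)"
  have c: "smooth_on U (\<lambda>q. r * c m q)"
    by (rule smooth_on_bounded_linear[OF open_U bounded_linear_mult_right c_smooth])
  have "D (lie_bracket (E k) (E i)) (E j) p = D (\<lambda>q. (r * c m q) *\<^sub>R E m q) (E j) p"
  proof (rule affine_connection_cong_left[OF D_affine open_U _ E_smooth _ p])
    show "smooth_on U (lie_bracket (E k) (E i))"
      by (intro levi_civita_smooth_lie_bracket[OF LC open_U] E_smooth)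
    show "lie_bracket (E k) (E i) q = (r * c m q) *\<^sub>R E m q" if "q \<in> U" for q
      by (auto simp: lie_bracket_E[OF that] r_def m_def)
  qed
  then show ?thesis
    unfolding affine_connection_scale_left[OF D_affine E_smooth E_smooth c p]
    by (simp add: r_def m_def)
qed

text \<open>The coordinate planes have sectional curvatures \<open>c' i - (c i)\<^sup>2\<close> for
  \<open>E i\<close>, \<open>E 3\<close> with \<open>i\<close> equal to 1 or 2, and
  \<open>- c 1 * c 2\<close> for \<open>E 1\<close>, \<open>E 2\<close>; the diagonal entries are
  sums of two of them.\<close>

lemma ricci_E:
  assumes p: "p \<in> U"
  shows "ricci g D E (E 1) (E 2) p = 0"
    and "ricci g D E (E 1) (E 1) p = c' 1 p - (c 1 p)\<^sup>2 - c 1 p * c 2 p"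
    and "ricci g D E (E 2) (E 2) p = c' 2 p - (c 2 p)\<^sup>2 - c 1 p * c 2 p"
    and "ricci g D E (E 3) (E 3) p = c' 1 p - (c 1 p)\<^sup>2 + (c' 2 p - (c 2 p)\<^sup>2)"
  \<comment> \<open>Signs are pushed into the scalars so that \<open>g_scale\<close> can extract
    them.\<close>
  by (simp_all add: ricci_def curvature_def sum_3 connection_connection_E[OF p]
      connection_lie_bracket_E[OF p] connection_E[OF p] g_diff g_add g_scale g_zero g_E_E[OF p]
      power2_eq_square scaleR_diff_right flip: scaleR_minus_left)

text \<open>The inner products are constant, and the bracket of the third coordinate field with
  \<open>E k\<close> is \<open>c k\<close> times \<open>E k\<close>; only the two bracket terms
  contribute.\<close>

lemma lie_deriv_metric_E:
  assumes p: "p \<in> U" and V: "\<And>q. q \<in> U \<Longrightarrow> V q = axis 3 1"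
  shows "lie_deriv_metric g V (E i) (E j) p = - 2 * of_bool (i = j) * c i p"
proof -
  have "frechet_derivative V (at p) = (\<lambda>_. 0)"
    using frechet_derivative_cong_open[OF open_U p V] by simp
  then have "lie_bracket V (E k) p = c k p *\<^sub>R E k p" for k
    by (simp add: lie_bracket_def E_frechet_derivative[OF p] V[OF p])
  then show ?thesis
    by (simp add: lie_deriv_metric_def vderiv_g_E[OF p] g_scale g_E_E[OF p] g_sym[of p "E i p"])
qed

end

section \<open>Constancy and differential equations on convex sets\<close>

lemma has_derivative_zero_constant_on:
  assumes "convex U" "\<And>p. p \<in> U \<Longrightarrow> (\<phi> has_derivative (\<lambda>_. 0)) (at p)"
  shows "\<phi> constant_on U"
  unfolding constant_on_def
  using has_derivative_zero_constant[OF assms(1) has_derivative_at_withinI[OF assms(2)]] .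

context diagonal_metric
begin

lemma F_constant_on_iff:
  assumes "convex U"
  shows "F k constant_on U \<longleftrightarrow> (\<forall>p\<in>U. c k p = 0)"
proof
  assume "F k constant_on U"
  then obtain C where "\<And>p. p \<in> U \<Longrightarrow> F k p = C"
    by (auto simp: constant_on_def)
  from frechet_derivative_cong_open[OF open_U _ this]
  show "\<forall>p\<in>U. c k p = 0" by (simp add: c_def)
next
  assume c: "\<forall>p\<in>U. c k p = 0"
  have "frechet_derivative (F k) (at p) = (\<lambda>_. 0)" if "p \<in> U" for p
    using c that by (simp add: fun_eq_iff F_frechet_derivative)
  then show "F k constant_on U"
    using smooth_on_has_derivative[OF F_smooth] by (intro has_derivative_zero_constant_on[OF assms]) metis
qed

lemma c'_eq_0:
  assumes "\<And>q. q \<in> U \<Longrightarrow> c k q = 0" "p \<in> U"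
  shows "c' k p = 0"
  using frechet_derivative_cong_open[OF open_U assms(2) assms(1)] by (simp add: c'_def)

lemma constant_coefficients:
  assumes "p0 \<in> U" and const: "f1 constant_on U" "f2 constant_on U"
  shows "constant_metric U g (g p0)"
proof (rule constant_metric.intro)
  have "bilinear (g p0)"
    unfolding bilinear_def by (auto intro!: linearI simp: g_tilde_def algebra_simps add_divide_distrib)
  then show "bounded_bilinear (g p0)"
    by (simp add: bilinear_conv_bounded_bilinear)
  show "u = 0" if "\<And>w. g p0 u w = 0" for u
    using that by (intro g_eqI[OF assms(1)]) (simp add: g_zero)
  show "g p = g p0" if "p \<in> U" for p
  proof -
    have "f1 p = f1 p0" "f2 p = f2 p0"
      using const that assms(1) by (auto simp: constant_on_def)
    then show ?thesis by (simp add: g_tilde_def fun_eq_iff)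
  qed
qed (rule open_U g_sym)+

text \<open>With the integrating factor \<open>exp (q $ 3)\<close> the product has derivative zero,
  hence is constant on the convex set.\<close>

lemma c_exponential:
  assumes "convex U" and ode: "\<And>p. p \<in> U \<Longrightarrow> c' k p = - c k p"
  shows "\<exists>K. \<forall>p\<in>U. c k p = K * exp (- (p $ 3))"
proof -
  have "((\<lambda>q. c k q * exp (q $ 3)) has_derivative (\<lambda>_. 0)) (at p)" if p: "p \<in> U" for p
  proof -
    have "(c k has_derivative (\<lambda>v. v $ 3 * c' k p)) (at p)"
      using smooth_on_has_derivative[OF c_smooth p] c_frechet_derivative[OF p]
      by (metis (no_types, lifting) ext)
    then show ?thesis
      by (auto intro!: derivative_eq_intros bounded_linear.has_derivative[OF bounded_linear_vec_nth]
          simp: ode[OF p])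
  qed
  from has_derivative_zero_constant_on[OF assms(1) this] obtain K
    where K: "\<And>p. p \<in> U \<Longrightarrow> c k p * exp (p $ 3) = K"
    by (auto simp: constant_on_def)
  have "c k p = K * exp (- (p $ 3))" if "p \<in> U" for p
    using K[OF that] by (auto simp: exp_minus field_simps)
  then show ?thesis by blast
qed

text \<open>An antiderivative of \<open>K * exp (- t)\<close> is \<open>- K * exp (- t)\<close>, so
  \<open>exp (K * exp (- t))\<close> is the integrating factor for \<open>F k\<close>.\<close>

lemma F_double_exponential:
  assumes "convex U" and c: "\<And>p. p \<in> U \<Longrightarrow> c k p = K * exp (- (p $ 3))"
  shows "\<exists>C. \<forall>p\<in>U. F k p = C * exp (- K * exp (- (p $ 3)))"
proof -
  have "((\<lambda>q. F k q * exp (K * exp (- (q $ 3)))) has_derivative (\<lambda>_. 0)) (at p)" if p: "p \<in> U" for p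
  proof -
    have "(F k has_derivative (\<lambda>v. v $ 3 * (c k p * F k p))) (at p)"
      using smooth_on_has_derivative[OF F_smooth p] F_frechet_derivative[OF p]
      by (metis (no_types, lifting) ext)
    then show ?thesis
      by (auto intro!: derivative_eq_intros bounded_linear.has_derivative[OF bounded_linear_vec_nth]
          simp: c[OF p])
  qed
  from has_derivative_zero_constant_on[OF assms(1) this] obtain C
    where C: "\<And>p. p \<in> U \<Longrightarrow> F k p * exp (K * exp (- (p $ 3))) = C"
    by (auto simp: constant_on_def)
  have "F k p = C * exp (- K * exp (- (p $ 3)))" if "p \<in> U" for p
    using C[OF that] by (auto simp: exp_minus field_simps)
  then show ?thesis by blast
qed

text \<open>Logarithmic derivatives do not see the constant nonzero factor \<open>r\<close>.\<close>

lemma c_eq_of_constant_ratio: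
  assumes "(\<lambda>p. f1 p / f2 p) constant_on U" and p: "p \<in> U"
  shows "c 1 p = c 2 p"
proof -
  obtain r where r: "\<And>q. q \<in> U \<Longrightarrow> f1 q / f2 q = r"
    using assms(1) by (auto simp: constant_on_def)
  have eq: "f1 q = r * f2 q" if "q \<in> U" for q
    using f2_nz[OF that] r[OF that] by (simp add: divide_eq_eq)
  have "((\<lambda>q. r * f2 q) has_derivative (\<lambda>v. r * frechet_derivative f2 (at p) v)) (at p)"
    by (intro has_derivative_mult_right smooth_on_has_derivative[OF f2_smooth p])
  then have "frechet_derivative (\<lambda>q. r * f2 q) (at p) = (\<lambda>v. r * frechet_derivative f2 (at p) v)"
    by (rule frechet_derivative_at[symmetric])
  moreover have "frechet_derivative f1 (at p) = frechet_derivative (\<lambda>q. r * f2 q) (at p)"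
    by (rule frechet_derivative_cong_open[OF open_U p eq])
  moreover have "r \<noteq> 0"
    using r[OF p] f1_nz[OF p] f2_nz[OF p] by auto
  ultimately show ?thesis
    by (simp add: c_def eq[OF p])
qed

end

section \<open>The box and the soliton equations\<close>

lemma open_box3: "open I1 \<Longrightarrow> open I2 \<Longrightarrow> open I3 \<Longrightarrow> open (box3 I1 I2 I3)"
  unfolding box3_def using open_vimage_vec_nth[unfolded vimage_def] by (intro open_Collect_conj) blast+

lemma convex_box3:
  assumes "convex I1" "convex I2" "convex I3"
  shows "convex (box3 I1 I2 I3)"
  using assms unfolding box3_def convex_def by simp

theorem proposition3p2:
  fixes I1 I2 I3 :: "real set" and I :: "(real^3) set"
    and f1 f2 f lam \<mu> :: "real^3 \<Rightarrow> real"
    and g :: "(real^3) tensor2" and D :: "(real^3) connection"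
    and E :: "3 \<Rightarrow> (real^3) vfield" and e :: "3 \<Rightarrow> (real^3) oneform"
    and V :: "(real^3) vfield" and \<eta> :: "(real^3) oneform"
    and \<eta>c :: "3 \<Rightarrow> real^3 \<Rightarrow> real"
  defines "I \<equiv> box3 I1 I2 I3" and "g \<equiv> g_tilde f1 f2" and "E \<equiv> frame3 f1 f2"
  assumes intervals: "open I1" "is_interval I1" "open I2" "is_interval I2" "open I3" "is_interval I3"
    and f1: "smooth_on I f1" "\<forall>p\<in>I. f1 p \<noteq> 0"
    and f2: "smooth_on I f2" "\<forall>p\<in>I. f2 p \<noteq> 0"
    and dual: "dual_coframe_on I E e"
    and LC: "levi_civita_on I g D"
    and soliton: "almost_eta_ricci_soliton I g D E V \<eta> lam \<mu>"
    and V: "\<forall>p\<in>I. V p = axis 3 1"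
    and f1_x3: "\<exists>h. \<forall>p\<in>I. f1 p = h (p $ 3)"
    and f2_x3: "\<exists>h. \<forall>p\<in>I. f2 p = h (p $ 3)"
    and eta: "\<forall>p\<in>I. \<forall>v. \<eta> p v = (\<Sum>k\<in>UNIV. \<eta>c k p * e k p v)"
    and eta_eq: "\<forall>k. \<forall>p\<in>I. \<eta>c k p = f p"
    and mu: "\<forall>p\<in>I. \<mu> p \<noteq> 0"
  shows "(\<forall>p\<in>I. \<forall>v. \<eta> p v = 0)
    \<and> (f1 constant_on I \<or> f2 constant_on I \<longrightarrow>
         f1 constant_on I \<and> f2 constant_on I \<and> flat_on I D \<and> (\<forall>p\<in>I. lam p = 0) \<and> killing_on I g V)
    \<and> ((\<lambda>p. f1 p / f2 p) constant_on I \<longrightarrow>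
         (\<exists>c0 c1 c2. c1 \<noteq> 0 \<and> c2 \<noteq> 0 \<and>
            (\<forall>p\<in>I. f1 p = c1 * exp (c0 * exp (- (p $ 3))) \<and>
                   f2 p = c2 * exp (c0 * exp (- (p $ 3))))))"
proof -
  have "open I" "convex I"
    using intervals by (auto simp: I_def is_interval_convex intro: open_box3 convex_box3)
  then interpret diagonal_metric I f1 f2 D
    using f1 f2 f1_x3 f2_x3 LC by unfold_locales (auto simp: g_def)
  \<comment> \<open>A soliton has \<mu> nonzero somewhere, so the box is nonempty. The point later
    fixes the constant metric and shows that \<open>c1\<close> and \<open>c2\<close> are
    nonzero.\<close>
  obtain p0 where p0: "p0 \<in> I"
    using soliton by (auto simp: almost_eta_ricci_soliton_def)
  have \<eta>E: "\<eta> p (E i p) = f p" if "p \<in> I" for p i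
    using eta eta_eq dual that exhaust_3[of i] by (auto simp: dual_coframe_on_def sum_3)
  \<comment> \<open>Equality of the components of \<eta> puts the same term
    \<open>\<mu> p * (f p)\<^sup>2\<close> into every entry, including the off-diagonal
    ones.\<close>
  have sol: "ricci g D E (E i) (E j) p - of_bool (i = j) * c i p + lam p * of_bool (i = j)
      + \<mu> p * (f p)\<^sup>2 = 0" if p: "p \<in> I" for p i j
  proof -
    have "1/2 * lie_deriv_metric g V (E i) (E j) p + ricci g D E (E i) (E j) p
        + lam p * g p (E i p) (E j p) + \<mu> p * (\<eta> p (E i p) * \<eta> p (E j p)) = 0"
      using soliton p E_smooth unfolding almost_eta_ricci_soliton_def E_def by blast
    moreover have "lie_deriv_metric g V (E i) (E j) p = - 2 * of_bool (i = j) * c i p"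
      unfolding g_def E_def by (rule lie_deriv_metric_E[OF p]) (use V in blast)
    moreover have "g p (E i p) (E j p) = of_bool (i = j)"
      unfolding g_def E_def by (rule g_E_E[OF p])
    ultimately show ?thesis
      by (simp add: \<eta>E[OF p] power2_eq_square algebra_simps)
  qed
  have f_0: "f p = 0" if "p \<in> I" for p
    using sol[OF that, of 1 2] ricci_E(1)[OF that] mu that by (simp add: g_def E_def)
  then have \<eta>_0: "\<forall>p\<in>I. \<forall>v. \<eta> p v = 0"
    using eta eta_eq by simp
  have eqs: "c' 1 p - (c 1 p)\<^sup>2 - c 1 p * c 2 p - c 1 p + lam p = 0"
      "c' 2 p - (c 2 p)\<^sup>2 - c 1 p * c 2 p - c 2 p + lam p = 0"
      "c' 1 p - (c 1 p)\<^sup>2 + (c' 2 p - (c 2 p)\<^sup>2) + lam p = 0" if "p \<in> I" for p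
    using sol[OF that, of 1 1] sol[OF that, of 2 2] sol[OF that, of 3 3] ricci_E[OF that] f_0[OF that]
    by (simp_all add: g_def E_def)
  have const_iff: "f1 constant_on I \<longleftrightarrow> (\<forall>p\<in>I. c 1 p = 0)" "f2 constant_on I \<longleftrightarrow> (\<forall>p\<in>I. c 2 p = 0)"
    using F_constant_on_iff[OF \<open>convex I\<close>, of 1] F_constant_on_iff[OF \<open>convex I\<close>, of 2] by simp_all
  have "f1 constant_on I \<and> f2 constant_on I \<and> flat_on I D \<and> (\<forall>p\<in>I. lam p = 0) \<and> killing_on I g V"
    if "f1 constant_on I \<or> f2 constant_on I"
  proof -
    have "c 1 p = 0 \<and> c 2 p = 0 \<and> lam p = 0" if p: "p \<in> I" for p
      using \<open>f1 constant_on I \<or> f2 constant_on I\<close> unfolding const_iff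
    proof
      assume "\<forall>p\<in>I. c 1 p = 0"
      \<comment> \<open>Vanishing on the whole open box also gives \<open>c' 1 p = 0\<close>; the
        second and third equations then differ exactly by \<open>c 2 p\<close>.\<close>
      then show ?thesis using eqs[OF p] c'_eq_0[of 1, OF _ p] p by simp
    next
      assume "\<forall>p\<in>I. c 2 p = 0"
      then show ?thesis using eqs[OF p] c'_eq_0[of 2, OF _ p] p by simp
    qed
    then have const: "f1 constant_on I" "f2 constant_on I" "\<forall>p\<in>I. lam p = 0"
      unfolding const_iff by blast+
    interpret constant_metric I g "g p0"
      unfolding g_def by (rule constant_coefficients[OF p0 const(1,2)])
    show ?thesis
      using const flat[OF \<open>levi_civita_on I g D\<close>] killing_const V by blast
  qed
  moreover have "\<exists>c0 c1 c2. c1 \<noteq> 0 \<and> c2 \<noteq> 0 \<and> (\<forall>p\<in>I. f1 p = c1 * exp (c0 * exp (- (p $ 3))) \<and>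
      f2 p = c2 * exp (c0 * exp (- (p $ 3))))" if ratio: "(\<lambda>p. f1 p / f2 p) constant_on I"
  proof -
    note c_eq = c_eq_of_constant_ratio[OF ratio]
    \<comment> \<open>The logarithmic derivatives agree on an open set, so they may be
      differentiated together.\<close>
    have "c' 1 p = c' 2 p" if "p \<in> I" for p
      using frechet_derivative_cong_open[OF open_U that c_eq] by (simp add: c'_def)
    then have "c' 1 p = - c 1 p" if "p \<in> I" for p
      using eqs[OF that] c_eq[OF that] that by (simp add: power2_eq_square)
    then obtain K where K: "\<And>p. p \<in> I \<Longrightarrow> c 1 p = K * exp (- (p $ 3))"
      using c_exponential[OF \<open>convex I\<close>, of 1] by blast
    \<comment> \<open>The witness for \<open>c0\<close> is \<open>- K\<close>. It serves both
      functions because \<open>c 1\<close> and \<open>c 2\<close> share the constant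
      \<open>K\<close>.\<close>
    obtain c1 where c1: "\<forall>p\<in>I. f1 p = c1 * exp (- K * exp (- (p $ 3)))"
      using F_double_exponential[OF \<open>convex I\<close> K] by auto
    obtain c2 where c2: "\<forall>p\<in>I. f2 p = c2 * exp (- K * exp (- (p $ 3)))"
      using F_double_exponential[OF \<open>convex I\<close>, of 2 K] K c_eq by auto
    have "c1 \<noteq> 0" "c2 \<noteq> 0"
      using c1 c2 f1_nz[OF p0] f2_nz[OF p0] p0 by auto
    with c1 c2 show ?thesis by blast
  qed
  ultimately show ?thesis using \<eta>_0 by blast
qed

end
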